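(* Let $E$ be a (real or complex) Banach space that has a finite dimensional decomposition. Then $E$ has a Schauder frame.
   Context: $\mathbb{N}^*=\{1,2,3,\dots\}$. $E$ has a finite dimensional decomposition (FDD) if there is a sequence $(E_n)_{n\in\mathbb{N}^*}$ of finite dimensional subspaces of $E$ such that every $x\in E$ admits a unique representation $x=\sum_{n=1}^\infty P_n(x)$ (norm convergent) with $P_n(x)\in E_n$ for all $n$; in this case each $P_n:E\to E_n$ is a bounded linear projection. A Schauder frame for $E$ is a sequence $((a_n,b_n^* ))_{n\in\mathbb{N}^*}$ in $E\times E^*$ such that for every $x\in E$ the series $\sum_n b_n^*(x)a_n$ converges in norm to $x$. *)

theory Defs
  imports "HOL-Analysis.Analysis"
begin

text \<open>
  The norm and the underlying real Banach space come from the class \<open>banach\<close>; a complex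
  structure is an additional scalar multiplication extending \<open>scaleR\<close>. For a real Banach space
  the definitions below are instantiated with \<open>scl = scaleR\<close>.
\<close>

locale complex_banach_space = vector_space scaleC
  for scaleC :: "complex \<Rightarrow> 'a::banach \<Rightarrow> 'a" +
  assumes scaleC_of_real: "scaleC (of_real r) x = r *\<^sub>R x"
    and norm_scaleC: "norm (scaleC c x) = cmod c * norm x"

definition finite_dim_subspace ::
    "('k::field \<Rightarrow> 'a::ab_group_add \<Rightarrow> 'a) \<Rightarrow> 'a set \<Rightarrow> bool" where
  "finite_dim_subspace scl S \<longleftrightarrow>
     module.subspace scl S \<and> (\<exists>B. finite B \<and> module.span scl B = S)"

text \<open>
  Sequences are indexed by \<open>nat\<close>, so that index \<open>n\<close> corresponds to the positive integer \<open>n + 1\<close>.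
\<close>

definition finite_dim_decomposition ::
    "('k::field \<Rightarrow> 'a::real_normed_vector \<Rightarrow> 'a) \<Rightarrow> (nat \<Rightarrow> 'a set) \<Rightarrow> bool" where
  "finite_dim_decomposition scl E \<longleftrightarrow>
     (\<forall>n. finite_dim_subspace scl (E n)) \<and>
     (\<forall>x. \<exists>!y. (\<forall>n. y n \<in> E n) \<and> y sums x)"

definition bounded_functional ::
    "('k::real_normed_field \<Rightarrow> 'a::real_normed_vector \<Rightarrow> 'a) \<Rightarrow> ('a \<Rightarrow> 'k) \<Rightarrow> bool" where
  "bounded_functional scl f \<longleftrightarrow>
     Vector_Spaces.linear scl (*) f \<and> (\<exists>K. \<forall>x. norm (f x) \<le> K * norm x)"

definition schauder_frame ::
    "('k::real_normed_field \<Rightarrow> 'a::real_normed_vector \<Rightarrow> 'a) \<Rightarrow>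
     (nat \<Rightarrow> 'a) \<Rightarrow> (nat \<Rightarrow> 'a \<Rightarrow> 'k) \<Rightarrow> bool" where
  "schauder_frame scl a b \<longleftrightarrow>
     (\<forall>n. bounded_functional scl (b n)) \<and>
     (\<forall>x. (\<lambda>n. scl (b n x) (a n)) sums x)"

lemma complex_banach_space_mult: "complex_banach_space ((*) :: complex \<Rightarrow> complex \<Rightarrow> complex)"
  by unfold_locales (simp_all add: algebra_simps norm_mult scaleR_conv_of_real)

lemma finite_dim_subspace_scaleR:
  "finite_dim_subspace scaleR S \<longleftrightarrow> subspace S \<and> (\<exists>B. finite B \<and> span B = S)"
  by (simp add: finite_dim_subspace_def subspace_raw_def span_raw_def)

lemma bounded_functional_scaleR: "bounded_functional scaleR f \<longleftrightarrow> bounded_linear f"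
proof -
  have mult: "(*) = (scaleR :: real \<Rightarrow> real \<Rightarrow> real)"
    by (intro ext) simp
  show ?thesis
    unfolding bounded_functional_def bounded_linear_def bounded_linear_axioms_def linear_def mult
    by (simp only: real_scaleR_def mult.commute)
qed

end

theory Submission
  imports Defs
begin

text \<open>
  Let \<open>e\<^sub>i, c\<^sub>i\<close> (\<open>i < d\<^sub>n\<close>) be a basis of \<open>E\<^sub>n\<close> with its coordinate functionals. Juxtaposing the
  expansions of the \<open>P\<^sub>n x\<close> converges along complete blocks, but the partial sums inside a block need
  not be bounded by a constant times \<open>norm (P\<^sub>n x)\<close> uniformly in \<open>n\<close>. So each block is repeated
  \<open>N\<^sub>n\<close> times with weight \<open>1 / N\<^sub>n\<close>: if \<open>N\<^sub>n\<close> dominates the sum of the \<open>norm c\<^sub>i * norm e\<^sub>i\<close>, then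
  the contribution of an incomplete copy is at most \<open>norm (P\<^sub>n x)\<close>, which tends to \<open>0\<close>.
\<close>

section \<open>Bounded projections\<close>

text \<open>
  The closed graph argument by hand: by Baire's theorem the vectors with small partial sums are
  dense near \<open>0\<close>, and successive approximation writes every \<open>x\<close> as an absolutely convergent series
  \<open>\<Sum>k. u k\<close> of such vectors; closedness of the \<open>E n\<close> identifies \<open>P x n\<close> with \<open>\<Sum>k. P (u k) n\<close>.
\<close>

lemma decomposition_projection_bounded:
  fixes E :: "nat \<Rightarrow> 'a::banach set"
  assumes sub: "\<And>n. subspace (E n)" and clo: "\<And>n. closed (E n)"
    and uniq: "\<And>x y z. \<lbrakk>\<And>n. y n \<in> E n; y sums x; \<And>n. z n \<in> E n; z sums x\<rbrakk> \<Longrightarrow> y = z"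
    and PE: "\<And>x n. P x n \<in> E n" and Psums: "\<And>x. P x sums x"
  obtains K where "\<And>x n. norm (P x n) \<le> K * norm x"
proof -
  have P_diff: "P (x - y) = (\<lambda>n. P x n - P y n)" for x y
    by (rule uniq) (auto intro: PE Psums sums_diff subspace_diff[OF sub])
  have P_scale: "P (c *\<^sub>R x) = (\<lambda>n. c *\<^sub>R P x n)" for c x
    by (rule uniq) (auto intro: PE Psums sums_scaleR_right subspace_mul[OF sub])
  define S where "S x N = (\<Sum>n<N. P x n)" for x N
  have S_lim: "S x \<longlonglongrightarrow> x" for x
    using Psums[of x] by (simp add: sums_def S_def[abs_def])
  have S_diff: "S (x - y) N = S x N - S y N" and S_scale: "S (c *\<^sub>R x) N = c *\<^sub>R S x N" for x y c N
    by (simp_all add: S_def P_diff P_scale sum_subtractf scaleR_sum_right)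
  \<comment> \<open>Convergent partial sums are bounded, so the sets \<open>G K\<close> exhaust the
    space and Baire's theorem applies to their closures.\<close>
  define G where "G K = {x. \<forall>N. norm (S x N) \<le> real K}" for K
  have cover: "(\<Union>K. closure (G K)) = UNIV"
  proof -
    have "\<exists>K. x \<in> G K" for x
    proof -
      obtain K where K: "\<And>N. norm (S x N) \<le> K"
        using S_lim[of x] by (metis convergent_def convergent_imp_Bseq BseqE)
      show ?thesis
        using K by (auto simp: G_def intro!: exI[of _ "nat \<lceil>K\<rceil>"] intro: order_trans real_nat_ceiling_ge)
    qed
    then show ?thesis
      using closure_subset by fast
  qed
  obtain K where "interior (closure (G K)) \<noteq> {}"
  proof (rule ccontr)
    assume "\<not> thesis"
    then have *: "interior (closure (G K)) = {}" for K
      using that by blast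
    have "euclidean interior_of \<Union>(range (\<lambda>K. closure (G K))) = {}"
      by (rule Baire_category_alt) (use * in \<open>auto simp: completely_metrizable_space_euclidean\<close>)
    with cover show False
      by simp
  qed
  then obtain x0 r where "r > 0" and r: "ball x0 r \<subseteq> closure (G K)"
    by (metis ex_in_conv mem_interior)
  have near0: "\<exists>u\<in>G K. norm (x - u) < e" if "norm x < r" "e > 0" for x e
  proof -
    have "x0 + x \<in> closure (G K)" "x0 - x \<in> closure (G K)"
      using r that by (auto simp: dist_norm subset_iff)
    then obtain v w where v: "v \<in> G K" "dist v (x0 + x) < e" and w: "w \<in> G K" "dist w (x0 - x) < e"
      using \<open>e > 0\<close> unfolding closure_approachable by blast
    \<comment> \<open>Halving the difference cancels the centre \<open>x0\<close>, since
      \<open>v\<close> is close to \<open>x0 + x\<close> and \<open>w\<close> to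
      \<open>x0 - x\<close>, and the bound \<open>K\<close> on partial sums survives.\<close>
    define u where "u = (1/2) *\<^sub>R (v - w)"
    have "norm (S u N) \<le> K" for N
    proof -
      have "norm (S v N) \<le> K" "norm (S w N) \<le> K"
        using v(1) w(1) by (simp_all add: G_def)
      then have "norm (S v N - S w N) \<le> K + K"
        using norm_triangle_ineq4[of "S v N" "S w N"] by linarith
      then show ?thesis
        by (simp add: u_def S_scale S_diff)
    qed
    moreover have "norm (x - u) < e"
    proof -
      have "x - u = (1/2) *\<^sub>R ((w - (x0 - x)) - (v - (x0 + x)))"
        by (simp add: u_def algebra_simps) (simp flip: scaleR_add_left)
      also have "norm \<dots> < e"
        using v(2) w(2) norm_triangle_ineq4[of "w - (x0 - x)" "v - (x0 + x)"]
        by (simp add: dist_norm)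
      finally show ?thesis .
    qed
    ultimately show ?thesis
      by (auto simp: G_def)
  qed
  define M where "M = 2 * real K / r"
  have "M \<ge> 0"
    using \<open>r > 0\<close> by (simp add: M_def)
  have "\<exists>u. (\<forall>N. norm (S u N) \<le> M * norm x) \<and> norm (x - u) \<le> norm x / 2" for x
  proof (cases "x = 0")
    case True
    have "S 0 N = 0" for N
      using S_diff[of 0 0] by simp
    with True show ?thesis
      by (intro exI[of _ 0]) simp
  next
    case False
    \<comment> \<open>\<open>t *\<^sub>R x\<close> has norm \<open>r / 2\<close>, inside the ball.
      Undoing the scaling turns the error \<open>r / 4\<close> into \<open>norm x / 2\<close> and
      the bound \<open>K\<close> into \<open>K / t\<close>, which is
      \<open>M * norm x\<close>.\<close>
    define t where "t = r / (2 * norm x)"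
    have t: "t > 0" "norm (t *\<^sub>R x) < r"
      using False \<open>r > 0\<close> by (auto simp: t_def)
    obtain u where u: "u \<in> G K" "norm (t *\<^sub>R x - u) < r / 4"
      using near0[OF t(2), of "r/4"] \<open>r > 0\<close> by auto
    have M: "M * norm x = K / t"
      using False \<open>r > 0\<close> by (simp add: M_def t_def)
    have "norm (S ((1/t) *\<^sub>R u) N) \<le> M * norm x" for N
      using u(1) t(1) by (auto simp: M S_scale G_def divide_right_mono)
    moreover have "norm (x - (1/t) *\<^sub>R u) \<le> norm x / 2"
    proof -
      have "x - (1/t) *\<^sub>R u = (1/t) *\<^sub>R (t *\<^sub>R x - u)"
        using t(1) by (simp add: algebra_simps)
      then have "norm (x - (1/t) *\<^sub>R u) = norm (t *\<^sub>R x - u) / t"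
        using t(1) by simp
      also have "\<dots> \<le> (r / 4) / t"
        using u(2) t(1) by (intro divide_right_mono) auto
      also have "\<dots> = norm x / 2"
        using False \<open>r > 0\<close> by (simp add: t_def)
      finally show ?thesis .
    qed
    ultimately show ?thesis
      by blast
  qed
  then obtain g where g: "\<And>x N. norm (S (g x) N) \<le> M * norm x" "\<And>x. norm (x - g x) \<le> norm x / 2"
    by metis
  have S_bound: "norm (S x N) \<le> 2 * M * norm x" for x N
  proof -
    \<comment> \<open>\<open>z k\<close> is the remainder after \<open>k\<close> corrections and
      \<open>u k\<close> the next correction. Each correction at least halves the bound on the
      remainder, so the \<open>u k\<close> add up to \<open>x\<close>.\<close>
    define z where "z k = ((\<lambda>x. x - g x) ^^ k) x" for k
    define u where "u k = g (z k)" for k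
    have z0: "z 0 = x" and zSuc: "z (Suc k) = z k - u k" for k
      by (simp_all add: z_def u_def)
    have z: "norm (z k) \<le> norm x * (1/2) ^ k" for k
    proof (induction k)
      case (Suc k)
      have "norm (z (Suc k)) \<le> norm (z k) / 2"
        using g(2)[of "z k"] by (simp only: zSuc u_def)
      with Suc show ?case
        by simp
    qed (simp add: z0)
    define b where "b k = M * norm x * (1/2) ^ k" for k :: nat
    have b_sums: "b sums (2 * M * norm x)"
      using sums_mult[OF geometric_sums[of "1/2::real"], of "M * norm x"] by (simp add: b_def[abs_def] mult_ac)
    then have b_summable: "summable b"
      by (rule sums_summable)
    have Sb: "norm (S (u k) n) \<le> b k" for k n
    proof -
      have "norm (S (u k) n) \<le> M * norm (z k)"
        by (simp add: u_def g)
      also have "\<dots> \<le> b k"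
        unfolding b_def using mult_left_mono[OF z \<open>M \<ge> 0\<close>] by (simp add: mult_ac)
      finally show ?thesis .
    qed
    have "z \<longlonglongrightarrow> 0"
    proof (rule Lim_null_comparison)
      show "(\<lambda>k. norm x * (1/2) ^ k) \<longlonglongrightarrow> 0"
        by (intro tendsto_mult_right_zero LIMSEQ_power_zero) simp
    qed (use z in auto)
    then have u_sums: "u sums x"
      using telescope_sums'[of z 0] by (simp add: z0 zSuc)
    have S_summable: "summable (\<lambda>k. S (u k) n)" for n
      by (rule summable_comparison_test[OF _ b_summable]) (use Sb in auto)
    have P_S: "P (u k) n = S (u k) (Suc n) - S (u k) n" for k n
      by (simp add: S_def)
    define y where "y n = (\<Sum>k. P (u k) n)" for n
    have P_summable: "summable (\<lambda>k. P (u k) n)" for n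
      unfolding P_S by (intro summable_diff S_summable)
    have y_E: "y n \<in> E n" for n
    proof (rule closed_sequentially[OF clo])
      show "(\<lambda>m. \<Sum>k<m. P (u k) n) \<longlonglongrightarrow> y n"
        unfolding y_def by (rule summable_LIMSEQ[OF P_summable])
      show "(\<Sum>k<m. P (u k) n) \<in> E n" for m
        by (intro subspace_sum sub PE)
    qed
    have y_sum: "(\<Sum>n<m. y n) = (\<Sum>k. S (u k) m)" for m
      unfolding y_def S_def by (rule suminf_sum[symmetric]) (rule P_summable)
    \<comment> \<open>Uniformity in \<open>n\<close> permits interchanging the two limits:
      \<open>S (u k) n\<close> tends to \<open>u k\<close> as \<open>n\<close> grows, and the
      \<open>u k\<close> sum to \<open>x\<close>.\<close>
    have "uniform_limit UNIV (\<lambda>m n. \<Sum>k<m. S (u k) n) (\<lambda>n. \<Sum>k. S (u k) n) sequentially"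
      by (rule Weierstrass_m_test[OF Sb b_summable])
    then have "(\<lambda>n. \<Sum>k. S (u k) n) \<longlonglongrightarrow> x"
    proof (rule swap_uniform_limit'[rotated 2])
      show "\<forall>\<^sub>F m in sequentially. ((\<lambda>n. \<Sum>k<m. S (u k) n) \<longlongrightarrow> (\<Sum>k<m. u k)) sequentially"
        by (intro always_eventually allI tendsto_sum S_lim)
      show "(\<lambda>m. \<Sum>k<m. u k) \<longlonglongrightarrow> x"
        using u_sums by (simp add: sums_def)
    qed auto
    then have "y sums x"
      by (simp add: sums_def y_sum)
    then have "y = P x"
      using uniq[OF y_E _ PE Psums] by blast
    then have "S x N = (\<Sum>k. S (u k) N)"
      by (simp add: S_def[of x] flip: y_sum)
    also have "norm \<dots> \<le> suminf b"
      by (rule norm_suminf_le[OF Sb b_summable])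
    also have "\<dots> = 2 * M * norm x"
      by (rule sums_unique[OF b_sums, symmetric])
    finally show ?thesis .
  qed
  show thesis
  proof
    fix x n
    have "P x n = S x (Suc n) - S x n"
      by (simp add: S_def)
    then show "norm (P x n) \<le> (4 * M) * norm x"
      using norm_triangle_ineq4[of "S x (Suc n)" "S x n"] S_bound[of x n] S_bound[of x "Suc n"]
      by simp
  qed
qed

section \<open>Enumeration of consecutive finite blocks\<close>

text \<open>Lexicographic listing of the pairs \<open>(n, j)\<close> with \<open>j < l n\<close>,
  provided that every \<open>l n\<close> is positive: an empty block would still contribute the pair
  \<open>(n, 0)\<close>.\<close>

primrec block_index :: "(nat \<Rightarrow> nat) \<Rightarrow> nat \<Rightarrow> nat \<times> nat" where
  "block_index l 0 = (0, 0)"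
| "block_index l (Suc m) =
     (case block_index l m of (n, j) \<Rightarrow> if Suc j < l n then (n, Suc j) else (Suc n, 0))"

lemma block_index_less:
  assumes "\<And>n. l n > 0"
  shows "snd (block_index l m) < l (fst (block_index l m))"
  by (induction m) (auto simp: assms split: prod.splits)

text \<open>Leaving a block at its last index completes the inner sum, which then joins the sum over
  full blocks.\<close>

lemma sum_block_index:
  fixes f :: "nat \<Rightarrow> nat \<Rightarrow> 'a::ab_group_add"
  assumes "\<And>n. l n > 0"
  shows "(\<Sum>i<m. case_prod f (block_index l i)) =
    (\<Sum>k<fst (block_index l m). \<Sum>j<l k. f k j) +
    (\<Sum>j<snd (block_index l m). f (fst (block_index l m)) j)"
proof (induction m)
  case (Suc m)
  obtain n j where nj: "block_index l m = (n, j)"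
    by fastforce
  have "l n = Suc j" if "\<not> Suc j < l n"
    using block_index_less[of l m] assms nj that by auto
  then show ?case
    using Suc nj by (auto simp: algebra_simps)
qed simp

text \<open>If the block number stayed below \<open>n\<close>, only finitely many pairs would be
  available, while \<open>m\<close> steps pass through \<open>m\<close> of them.\<close>

lemma filterlim_fst_block_index:
  assumes "\<And>n. l n > 0"
  shows "filterlim (\<lambda>m. fst (block_index l m)) at_top sequentially"
proof -
  have mono: "mono (\<lambda>m. fst (block_index l m))"
    by (rule mono_iff_le_Suc[THEN iffD2]) (auto split: prod.splits)
  have "\<exists>m. fst (block_index l m) \<ge> n" for n
  proof (rule ccontr)
    assume "\<not> ?thesis"
    then have less: "fst (block_index l m) < n" for m
      by (meson not_le)
    \<comment> \<open>The count is \<open>sum_block_index\<close> for the constant function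
      \<open>1\<close>, taken in \<open>int\<close> because that lemma asks for a group.\<close>
    have "int m \<le> (\<Sum>k<n. int (l k))" for m
    proof -
      let ?p = "fst (block_index l m)" and ?j = "snd (block_index l m)"
      have "int m = (\<Sum>k<?p. int (l k)) + int ?j"
        using sum_block_index[of l "\<lambda>_ _. 1::int" m] assms by (simp add: split_def)
      also have "\<dots> \<le> (\<Sum>k<Suc ?p. int (l k))"
        using block_index_less[of l m] assms by simp
      also have "\<dots> \<le> (\<Sum>k<n. int (l k))"
        using less[of m] by (intro sum_mono2) auto
      finally show ?thesis .
    qed
    from this[of "Suc (nat (\<Sum>k<n. int (l k)))"] show False
      by linarith
  qed
  then show ?thesis
    unfolding filterlim_at_top eventually_sequentially
    by (metis mono monoD order_trans)
qed

text \<open>A partial sum splits into full blocks, whose sums converge to \<open>x\<close>, and one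
  incomplete block, which \<open>g\<close> forces to \<open>0\<close> because the block number tends
  to infinity.\<close>

lemma sums_block_index:
  fixes f :: "nat \<Rightarrow> nat \<Rightarrow> 'a::real_normed_vector"
  assumes l: "\<And>n. l n > 0"
    and sums: "(\<lambda>n. \<Sum>j<l n. f n j) sums x"
    and bound: "\<And>n r. r < l n \<Longrightarrow> norm (\<Sum>j<r. f n j) \<le> g n" and g: "g \<longlonglongrightarrow> 0"
  shows "(\<lambda>m. case_prod f (block_index l m)) sums x"
proof -
  note lim = filterlim_fst_block_index[of l, OF l]
  have "(\<lambda>m. \<Sum>k<fst (block_index l m). \<Sum>j<l k. f k j) \<longlonglongrightarrow> x"
    using filterlim_compose[OF sums[unfolded sums_def] lim] .
  moreover have "(\<lambda>m. \<Sum>j<snd (block_index l m). f (fst (block_index l m)) j) \<longlonglongrightarrow> 0"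
  proof (rule Lim_null_comparison)
    show "(\<lambda>m. g (fst (block_index l m))) \<longlonglongrightarrow> 0"
      using filterlim_compose[OF g lim] .
    show "\<forall>\<^sub>F m in sequentially. norm (\<Sum>j<snd (block_index l m). f (fst (block_index l m)) j)
        \<le> g (fst (block_index l m))"
      by (intro always_eventually allI bound block_index_less l)
  qed
  ultimately show ?thesis
    unfolding sums_def sum_block_index[of l, OF l] using tendsto_add by fastforce
qed

section \<open>Finite dimensional subspaces\<close>

text \<open>Common setting for the real and the complex case. Completeness of the scalars provides
  limits of coefficient sequences.\<close>

locale normed_space_over = vector_space scl
  for scl :: "'k::{real_normed_field, complete_space} \<Rightarrow> 'a::banach \<Rightarrow> 'a" +
  assumes scl_of_real: "scl (of_real r) x = r *\<^sub>R x"
    and norm_scl: "norm (scl c x) = norm c * norm x"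
begin

lemma real_subspace: "subspace S \<Longrightarrow> Real_Vector_Spaces.subspace S"
  unfolding Real_Vector_Spaces.subspace_def
  by (auto simp: subspace_0 subspace_add subspace_scale simp flip: scl_of_real)

lemma bounded_linear_scl_left: "bounded_linear (\<lambda>c. scl c x)"
proof (rule bounded_linear_intro)
  show "scl (r *\<^sub>R c) x = r *\<^sub>R scl c x" for r c
    by (simp add: scaleR_conv_of_real flip: scl_of_real)
  show "norm (scl c x) \<le> norm c * norm x" for c
    by (simp add: norm_scl)
qed (simp add: scale_left_distrib)

lemma bounded_linear_scl_right: "bounded_linear (scl c)"
proof (rule bounded_linear_intro)
  show "scl c (r *\<^sub>R x) = r *\<^sub>R scl c x" for r x
    by (simp add: mult.commute flip: scl_of_real)
  show "norm (scl c x) \<le> norm x * norm c" for x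
    by (simp add: norm_scl)
qed (simp add: scale_right_distrib)

text \<open>The bound makes the coefficients of a Cauchy sequence Cauchy; their limits are the
  coefficients of its limit.\<close>

lemma closed_span_if_coefficients_bounded:
  assumes fin: "finite B"
    and K: "\<And>u b. b \<in> B \<Longrightarrow> norm (u b) \<le> K * norm (\<Sum>b\<in>B. scl (u b) b)"
  shows "closed (span B)"
proof (rule complete_imp_closed, rule completeI)
  fix f assume f: "\<forall>n. f n \<in> span B" and Cauchy: "Cauchy f"
  have "\<exists>u. \<forall>n. f n = (\<Sum>b\<in>B. scl (u n b) b)"
    using f unfolding span_finite[OF fin] by (intro choice) auto
  then obtain u where u: "\<And>n. f n = (\<Sum>b\<in>B. scl (u n b) b)"
    by blast
  have "Cauchy (\<lambda>n. u n b)" if "b \<in> B" for b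
  proof (rule CauchyI)
    fix e :: real assume "e > 0"
    \<comment> \<open>No sign of \<open>K\<close> is given, so a positive upper bound replaces
      it.\<close>
    then have "e / (\<bar>K\<bar> + 1) > 0"
      by simp
    then obtain M where M: "\<And>m n. m \<ge> M \<Longrightarrow> n \<ge> M \<Longrightarrow> norm (f m - f n) < e / (\<bar>K\<bar> + 1)"
      using CauchyD[OF Cauchy] by blast
    have "norm (u m b - u n b) < e" if "m \<ge> M" "n \<ge> M" for m n
    proof -
      have "norm (u m b - u n b) \<le> K * norm (f m - f n)"
        using K[of b "\<lambda>b. u m b - u n b"] \<open>b \<in> B\<close>
        by (simp add: u scale_left_diff_distrib sum_subtractf)
      also have "\<dots> \<le> (\<bar>K\<bar> + 1) * norm (f m - f n)"
        by (intro mult_right_mono) auto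
      also have "\<dots> < e"
        using M[OF that] by (simp add: field_simps)
      finally show ?thesis .
    qed
    then show "\<exists>M. \<forall>m\<ge>M. \<forall>n\<ge>M. norm (u m b - u n b) < e"
      by blast
  qed
  then have "\<forall>b. \<exists>v. b \<in> B \<longrightarrow> (\<lambda>n. u n b) \<longlonglongrightarrow> v"
    using Cauchy_convergent convergent_def by blast
  then obtain v where v: "\<And>b. b \<in> B \<Longrightarrow> (\<lambda>n. u n b) \<longlonglongrightarrow> v b"
    by metis
  have "f \<longlonglongrightarrow> (\<Sum>b\<in>B. scl (v b) b)"
    unfolding u by (intro tendsto_sum bounded_linear.tendsto[OF bounded_linear_scl_left] v)
  moreover have "(\<Sum>b\<in>B. scl (v b) b) \<in> span B"
    by (intro span_sum span_scale span_base)
  ultimately show "\<exists>l\<in>span B. f \<longlonglongrightarrow> l"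
    by blast
qed

text \<open>When \<open>v\<close> is adjoined to \<open>F\<close>, the span of \<open>F\<close> is
  closed by induction, hence at positive distance from \<open>v\<close>. This bounds the coefficient
  of \<open>v\<close>; subtracting its term leaves the bound for \<open>F\<close>.\<close>

lemma independent_coefficients_bounded:
  assumes "finite B" "independent B"
  shows "\<exists>K. \<forall>u. \<forall>b\<in>B. norm (u b) \<le> K * norm (\<Sum>b\<in>B. scl (u b) b)"
  using assms
proof (induction B)
  case (insert v F)
  have v: "v \<notin> span F" and "independent F"
    using insert.prems insert.hyps by (simp_all add: independent_insert)
  then obtain K where K: "\<And>u b. b \<in> F \<Longrightarrow> norm (u b) \<le> K * norm (\<Sum>b\<in>F. scl (u b) b)"
    using insert.IH by blast
  have "closed (span F)"
    by (rule closed_span_if_coefficients_bounded[OF insert.hyps(1) K])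
  then have "open (- span F)"
    by (simp add: open_Compl)
  then obtain d where "d > 0" and d: "ball v d \<subseteq> - span F"
    using v by (meson ComplI open_contains_ball)
  have dist: "d \<le> norm (v + w)" if "w \<in> span F" for w
  proof -
    have "- w \<notin> ball v d"
      using d span_neg[OF that] by blast
    then show ?thesis
      by (simp add: dist_norm)
  qed
  \<comment> \<open>The first entry serves \<open>b = v\<close>. The second serves \<open>b\<close>
    in \<open>F\<close>, where removing the \<open>v\<close> term costs a factor
    \<open>1 + norm v / d\<close>.\<close>
  define K' where "K' = max (1 / d) (\<bar>K\<bar> * (1 + norm v / d))"
  have "norm (u b) \<le> K' * norm (\<Sum>b\<in>insert v F. scl (u b) b)" if "b \<in> insert v F" for u b
  proof -
    define w where "w = (\<Sum>b\<in>F. scl (u b) b)"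
    define x where "x = scl (u v) v + w"
    have w: "w \<in> span F"
      unfolding w_def by (intro span_sum span_scale span_base)
    have uv: "norm (u v) \<le> norm x / d"
    proof (cases "u v = 0")
      case False
      \<comment> \<open>Factoring out \<open>u v\<close> leaves \<open>v\<close> plus an element of
        the span of \<open>F\<close>, a vector of norm at least \<open>d\<close>.\<close>
      have "x = scl (u v) (v + scl (inverse (u v)) w)"
        using False by (simp add: x_def scale_right_distrib)
      then have "norm x = norm (u v) * norm (v + scl (inverse (u v)) w)"
        by (simp add: norm_scl)
      also have "\<dots> \<ge> norm (u v) * d"
        by (intro mult_left_mono dist span_scale w) simp
      finally show ?thesis
        using \<open>d > 0\<close> by (simp add: field_simps)
    qed (use \<open>d > 0\<close> in simp)
    have "norm (u b) \<le> K' * norm x"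
    proof (cases "b = v")
      case True
      have "norm (u v) \<le> (1 / d) * norm x"
        using uv by simp
      also have "\<dots> \<le> K' * norm x"
        by (intro mult_right_mono) (auto simp: K'_def)
      finally show ?thesis
        using True by simp
    next
      case False
      then have "norm (u b) \<le> K * norm w"
        using K[of b u] that by (simp add: w_def)
      also have "\<dots> \<le> \<bar>K\<bar> * norm w"
        by (intro mult_right_mono) auto
      also have "norm w \<le> norm x + norm (u v) * norm v"
        using norm_triangle_ineq4[of x "scl (u v) v"] by (simp add: x_def norm_scl)
      also have "\<dots> \<le> norm x + norm x / d * norm v"
        using uv by (intro add_left_mono mult_right_mono) auto
      also have "\<bar>K\<bar> * (norm x + norm x / d * norm v) = \<bar>K\<bar> * (1 + norm v / d) * norm x"
        by (simp add: algebra_simps)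
      also have "\<dots> \<le> K' * norm x"
        by (intro mult_right_mono) (auto simp: K'_def)
      finally show ?thesis
        by (simp add: mult_left_mono)
    qed
    then show ?thesis
      using insert.hyps by (simp add: x_def w_def)
  qed
  then show ?case
    by blast
qed simp

text \<open>
  The index \<open>i\<close> of \<open>c i\<close> is unrestricted, and \<open>d\<close> may exceed the dimension: padding with \<open>0\<close> makes
  \<open>d > 0\<close> possible for the zero subspace, so that no block of the enumeration is empty.
\<close>

definition coordinate_system ::
    "'a set \<Rightarrow> nat \<Rightarrow> (nat \<Rightarrow> 'a) \<Rightarrow> (nat \<Rightarrow> 'a \<Rightarrow> 'k) \<Rightarrow> real \<Rightarrow> bool" where
  "coordinate_system S d e c K \<longleftrightarrow> K \<ge> 0 \<and>
    (\<forall>x\<in>S. \<forall>y\<in>S. \<forall>i. c i (x + y) = c i x + c i y) \<and>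
    (\<forall>x\<in>S. \<forall>t i. c i (scl t x) = t * c i x) \<and>
    (\<forall>x\<in>S. \<forall>i. norm (c i x) \<le> K * norm x) \<and>
    (\<forall>x\<in>S. (\<Sum>i<d. scl (c i x) (e i)) = x)"

lemma finite_dim_subspace_coordinates:
  assumes "finite_dim_subspace scl S"
  obtains d e c K where "closed S" "d > 0" "coordinate_system S d e c K"
proof -
  obtain A where S: "subspace S" and A: "finite A" "span A = S"
    using assms by (auto simp: finite_dim_subspace_def)
  obtain B where B: "B \<subseteq> S" "independent B" "S \<subseteq> span B"
    using maximal_independent_subset[of S] by blast
  have span_B: "span B = S"
    using B S span_minimal by blast
  have "finite B"
    using independent_span_bound[OF A(1) B(2)] A(2) B(1) by simp
  then obtain K where K: "\<And>u b. b \<in> B \<Longrightarrow> norm (u b) \<le> K * norm (\<Sum>b\<in>B. scl (u b) b)"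
    using independent_coefficients_bounded[OF _ B(2)] by blast
  have closed: "closed S"
    using closed_span_if_coefficients_bounded[OF \<open>finite B\<close> K] by (simp add: span_B)
  obtain e0 where e0: "bij_betw e0 {..<card B} B"
    using \<open>finite B\<close> ex_bij_betw_nat_finite by (metis lessThan_atLeast0)
  define e where "e i = (if i < card B then e0 i else 0)" for i
  define c where "c i x = (if i < card B then representation B x (e0 i) else 0)" for i x
  have repr: "(\<Sum>b\<in>B. scl (representation B x b) b) = x" if "x \<in> S" for x
    using that B(2) \<open>finite B\<close> span_B by (intro sum_representation_eq) auto
  \<comment> \<open>For empty \<open>B\<close> the constant \<open>K\<close> is arbitrary, hence
    \<open>max K 0\<close>; the \<open>Suc\<close> accounts for the padding vector
    \<open>0\<close>.\<close>
  have "coordinate_system S (Suc (card B)) e c (max K 0)"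
    unfolding coordinate_system_def
  proof (intro conjI ballI allI)
    show "c i (x + y) = c i x + c i y" if "x \<in> S" "y \<in> S" for x y i
      using that B(2) by (simp add: c_def representation_add span_B)
    show "c i (scl t x) = t * c i x" if "x \<in> S" for t x i
      using that B(2) by (simp add: c_def representation_scale span_B)
    show "norm (c i x) \<le> max K 0 * norm x" if "x \<in> S" for x i
    proof (cases "i < card B")
      case True
      then have "norm (c i x) \<le> K * norm x"
        using K[of "e0 i" "representation B x"] repr[OF that] bij_betwE[OF e0] by (simp add: c_def)
      also have "\<dots> \<le> max K 0 * norm x"
        by (intro mult_right_mono) auto
      finally show ?thesis .
    qed (simp add: c_def)
    show "(\<Sum>i<Suc (card B). scl (c i x) (e i)) = x" if "x \<in> S" for x
    proof -
      have "(\<Sum>i<Suc (card B). scl (c i x) (e i)) = (\<Sum>i<card B. scl (representation B x (e0 i)) (e0 i))"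
        by (simp add: c_def e_def)
      also have "\<dots> = (\<Sum>b\<in>B. scl (representation B x b) b)"
        by (rule sum.reindex_bij_betw[OF e0])
      finally show ?thesis
        using repr[OF that] by simp
    qed
  qed simp
  with closed show thesis
    by (intro that) auto
qed

section \<open>The Schauder frame\<close>

theorem finite_dim_decomposition_imp_schauder_frame:
  assumes "finite_dim_decomposition scl E"
  shows "\<exists>a b. schauder_frame scl a b"
proof -
  have fin: "finite_dim_subspace scl (E n)" for n
    using assms by (simp add: finite_dim_decomposition_def)
  then have sub: "subspace (E n)" for n
    by (simp add: finite_dim_subspace_def)
  have uniq: "y = z" if "\<And>n. y n \<in> E n" "y sums x" "\<And>n. z n \<in> E n" "z sums x" for x y z
    using assms that unfolding finite_dim_decomposition_def by blast
  obtain P where PE: "\<And>x n. P x n \<in> E n" and Psums: "\<And>x. P x sums x"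
    using assms unfolding finite_dim_decomposition_def by metis
  have P_add: "P (x + y) = (\<lambda>n. P x n + P y n)" for x y
    by (rule uniq) (auto intro: PE Psums sums_add subspace_add[OF sub])
  have P_scale: "P (scl t x) = (\<lambda>n. scl t (P x n))" for t x
    by (rule uniq)
      (auto intro: PE Psums bounded_linear.sums[OF bounded_linear_scl_right] subspace_scale[OF sub])
  have "\<exists>d e c K. closed (E n) \<and> d > 0 \<and> coordinate_system (E n) d e c K" for n
    using finite_dim_subspace_coordinates[OF fin[of n]] by metis
  then obtain d e c K where closed: "\<And>n. closed (E n)" and d: "\<And>n. d n > 0"
    and coord: "\<And>n. coordinate_system (E n) (d n) (e n) (c n) (K n)"
    by metis
  have K: "K n \<ge> 0"
    and c_add: "x \<in> E n \<Longrightarrow> y \<in> E n \<Longrightarrow> c n i (x + y) = c n i x + c n i y"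
    and c_scale: "x \<in> E n \<Longrightarrow> c n i (scl t x) = t * c n i x"
    and c_bound: "x \<in> E n \<Longrightarrow> norm (c n i x) \<le> K n * norm x"
    and c_sum: "x \<in> E n \<Longrightarrow> (\<Sum>i<d n. scl (c n i x) (e n i)) = x" for n x y t i
    using coord[of n] by (auto simp: coordinate_system_def)
  obtain M where M: "\<And>x n. norm (P x n) \<le> M * norm x"
  proof (rule decomposition_projection_bounded[of E P])
    show "y = z" if "\<And>n. y n \<in> E n" "y sums x" "\<And>n. z n \<in> E n" "z sums x" for x y z
      using that by (rule uniq)
  qed (use real_subspace[OF sub] closed PE Psums in auto)
  \<comment> \<open>For \<open>x\<close> in \<open>E n\<close> the norms of all coordinate terms of
    \<open>x\<close> add up to at most \<open>C n * norm x\<close>; this is what \<open>N n\<close>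
    has to absorb.\<close>
  define C where "C n = (\<Sum>i<d n. K n * norm (e n i))" for n
  define N where "N n = Suc (nat \<lceil>C n\<rceil>)" for n
  have N: "N n > 0" "C n \<le> N n" for n
    unfolding N_def by linarith+
  \<comment> \<open>Two nested enumerations: \<open>block_index N\<close> lists the copies, so that
    \<open>p\<close> takes each value \<open>n\<close> exactly \<open>N n\<close> times in
    succession, and \<open>block_index D\<close> lists the coordinates inside each copy.\<close>
  define p where "p m = fst (block_index N m)" for m
  define D where "D m = d (p m)" for m
  define a where "a m = (case block_index D m of (k, i) \<Rightarrow> e (p k) i)" for m
  define b where "b m x = (case block_index D m of (k, i) \<Rightarrow>
      of_real (1 / N (p k)) * c (p k) i (P x (p k)))" for m x
  have partial: "norm (\<Sum>i<r. scl (of_real (1 / N n) * c n i (P x n)) (e n i)) \<le> norm (P x n)"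
    if "r < d n" for n r x
  proof -
    have "norm (\<Sum>i<r. scl (of_real (1 / N n) * c n i (P x n)) (e n i))
        \<le> (\<Sum>i<r. norm (scl (of_real (1 / N n) * c n i (P x n)) (e n i)))"
      by (rule norm_sum)
    also have "\<dots> \<le> (\<Sum>i<d n. norm (scl (of_real (1 / N n) * c n i (P x n)) (e n i)))"
      using that by (intro sum_mono2) auto
    also have "\<dots> \<le> (\<Sum>i<d n. 1 / N n * (K n * norm (P x n)) * norm (e n i))"
      using N(1)[of n] by (intro sum_mono) (auto simp: norm_scl norm_mult norm_divide intro!: mult_right_mono divide_right_mono c_bound PE)
    also have "\<dots> = C n / N n * norm (P x n)"
      by (simp add: C_def sum_distrib_left sum_distrib_right sum_divide_distrib mult_ac)
    also have "\<dots> \<le> 1 * norm (P x n)"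
      using N[of n] by (intro mult_right_mono) auto
    finally show ?thesis
      by simp
  qed
  have "(\<lambda>m. scl (b m x) (a m)) sums x" for x
  proof -
    have lim: "(\<lambda>n. norm (P x n)) \<longlonglongrightarrow> 0"
      using Psums[of x] by (intro tendsto_norm_zero summable_LIMSEQ_zero) (rule sums_summable)
    \<comment> \<open>First level, with whole copies as terms: \<open>N n\<close> of them add up to
      \<open>P x n\<close>, and fewer have a sum of norm at most
      \<open>norm (P x n)\<close>.\<close>
    have "(\<lambda>m. case_prod (\<lambda>n _. (1 / N n) *\<^sub>R P x n) (block_index N m)) sums x"
    proof (rule sums_block_index[OF N(1) _ _ lim])
      show "(\<lambda>n. \<Sum>j<N n. (1 / N n) *\<^sub>R P x n) sums x"
        using Psums[of x] by (simp add: sum_constant_scaleR N_def)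
      show "norm (\<Sum>j<r. (1 / N n) *\<^sub>R P x n) \<le> norm (P x n)" if "r < N n" for n r
        using that by (simp add: sum_constant_scaleR divide_le_eq mult.commute mult_right_mono)
    qed
    then have "(\<lambda>m. (1 / N (p m)) *\<^sub>R P x (p m)) sums x"
      by (simp add: p_def split_def)
    moreover have "(\<Sum>i<D k. scl (of_real (1 / N (p k)) * c (p k) i (P x (p k))) (e (p k) i)) =
        (1 / N (p k)) *\<^sub>R P x (p k)" for k
      using c_sum[OF PE, of "p k" x]
      by (simp only: D_def scl_of_real flip: scale_scale scaleR_sum_right)
    ultimately have "(\<lambda>k. \<Sum>i<D k. scl (of_real (1 / N (p k)) * c (p k) i (P x (p k))) (e (p k) i)) sums x"
      by simp
    \<comment> \<open>Second level, with copies resolved into coordinate terms: an incomplete copy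
      is controlled by \<open>partial\<close>, and this bound vanishes because \<open>p k\<close>
      tends to infinity.\<close>
    then have "(\<lambda>m. case_prod (\<lambda>k i. scl (of_real (1 / N (p k)) * c (p k) i (P x (p k))) (e (p k) i))
        (block_index D m)) sums x"
    proof (rule sums_block_index[rotated])
      show "D n > 0" for n
        by (simp add: D_def d)
      show "norm (\<Sum>i<r. scl (of_real (1 / N (p k)) * c (p k) i (P x (p k))) (e (p k) i))
          \<le> norm (P x (p k))" if "r < D k" for r k
        using partial that by (simp add: D_def)
      show "(\<lambda>k. norm (P x (p k))) \<longlonglongrightarrow> 0"
        unfolding p_def by (rule filterlim_compose[OF lim filterlim_fst_block_index[OF N(1)]])
    qed
    then show ?thesis
      by (simp add: a_def b_def split_def)
  qed
  moreover have "bounded_functional scl (b m)" for m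
  proof -
    obtain k i where ki: "block_index D m = (k, i)"
      by fastforce
    define n where "n = p k"
    have b: "b m = (\<lambda>x. of_real (1 / N n) * c n i (P x n))"
      by (simp add: b_def ki n_def fun_eq_iff)
    \<comment> \<open>Linearity of \<open>c n i\<close> is available only on \<open>E n\<close>,
      which suffices since \<open>P x n\<close> lies there.\<close>
    have "Vector_Spaces.linear scl (*) (b m)"
      unfolding Vector_Spaces.linear_iff b
      by (auto simp: P_add P_scale c_add[OF PE PE] c_scale[OF PE] algebra_simps
          vector_space_axioms intro!: vector_space.intro)
    moreover have "norm (b m x) \<le> (1 / N n * (K n * M)) * norm x" for x
    proof -
      have "norm (b m x) = 1 / N n * norm (c n i (P x n))"
        by (simp add: b norm_mult norm_divide)
      also have "\<dots> \<le> 1 / N n * (K n * norm (P x n))"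
        by (intro mult_left_mono c_bound PE) simp
      also have "\<dots> \<le> 1 / N n * (K n * (M * norm x))"
        by (intro mult_left_mono M K) simp
      finally show ?thesis
        by (simp add: mult_ac)
    qed
    ultimately show ?thesis
      unfolding bounded_functional_def by blast
  qed
  ultimately show ?thesis
    unfolding schauder_frame_def by blast
qed

end

theorem proposition1:
  fixes scaleC :: "complex \<Rightarrow> 'c::banach \<Rightarrow> 'c"
  shows
    "((\<exists>E. finite_dim_decomposition (scaleR :: real \<Rightarrow> 'r::banach \<Rightarrow> 'r) E) \<longrightarrow>
      (\<exists>a b. schauder_frame (scaleR :: real \<Rightarrow> 'r \<Rightarrow> 'r) a b)) \<and>
     (complex_banach_space scaleC \<longrightarrow>
      (\<exists>E. finite_dim_decomposition scaleC E) \<longrightarrow>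
      (\<exists>a b. schauder_frame scaleC a b))"
proof (intro conjI impI)
  interpret normed_space_over "scaleR :: real \<Rightarrow> 'r \<Rightarrow> 'r"
    by unfold_locales (simp_all add: algebra_simps)
  show "\<exists>a b. schauder_frame (scaleR :: real \<Rightarrow> 'r \<Rightarrow> 'r) a b"
    if "\<exists>E. finite_dim_decomposition (scaleR :: real \<Rightarrow> 'r \<Rightarrow> 'r) E"
    using that finite_dim_decomposition_imp_schauder_frame by blast
next
  assume "complex_banach_space scaleC" and E: "\<exists>E. finite_dim_decomposition scaleC E"
  then interpret complex_banach_space scaleC
    by simp
  interpret normed_space_over scaleC
    by unfold_locales (simp_all add: scaleC_of_real norm_scaleC)
  show "\<exists>a b. schauder_frame scaleC a b"
    using E finite_dim_decomposition_imp_schauder_frame by blast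
qed

end
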